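(* Let $\omega$ be a weight. Let $f$ be a polynomial with simple zeros such that $Z(f)\cap\mathbb{D}=\emptyset$, and for each $n\in\mathbb{N}$ let $p_n$ be the $n$-th optimal polynomial approximant to $1/f$ in $H^2_\omega$. Then there exists a constant $C>0$ such that for all $n\in\mathbb{N}$, $$\|1-p_nf\|_{\mathcal{A}(\mathbb{T})}\le C.$$
   Context: $\mathbb{N}=\{0,1,2,\dots\}$, $\mathbb{D}=\{z\in\mathbb{C}:|z|<1\}$, $\mathbb{T}=\{z\in\mathbb{C}:|z|=1\}$; $Z(f)$ is the set of zeros of $f$ in $\mathbb{C}$. A weight is a monotone (nondecreasing or nonincreasing) sequence $\omega=\{\omega_k\}_{k\in\mathbb{N}}$ of positive reals with $\omega_0=1$, $\lim_{n\to\infty}\omega_n/\omega_{n-\lfloor\sqrt n\rfloor}=1$, and $\sum_{k=1}^\infty 1/\omega_k=+\infty$. $H^2_\omega$ is the Hilbert space of holomorphic functions $g(z)=\sum_{k\ge0}a_kz^k$ on $\mathbb{D}$ with $\|g\|_\omega^2=\sum_{k\ge0}|a_k|^2\omega_k<\infty$. $\mathcal{P}_n$ is the space of complex polynomials of degree at most $n$. For $f\in H^2_\omega$ not identically zero, the $n$-th optimal polynomial approximant to $1/f$ in $H^2_\omega$ is the unique $p_n\in\mathcal{P}_n$ such that $\|1-p_nf\|_\omega\le\|1-qf\|_\omega$ for all $q\in\mathcal{P}_n$. The Wiener algebra norm of $g(z)=\sum_{k\in\mathbb{N}}a_kz^k$ is $\|g\|_{\mathcal{A}(\mathbb{T})}=\sum_{k\in\mathbb{N}}|a_k|$.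 *)

theory Defs
  imports "HOL-Complex_Analysis.Complex_Analysis" "HOL-Computational_Algebra.Computational_Algebra"
begin

definition is_weight :: "(nat \<Rightarrow> real) \<Rightarrow> bool" where
  "is_weight \<omega> \<longleftrightarrow>
     (mono \<omega> \<or> antimono \<omega>) \<and> (\<forall>k. \<omega> k > 0) \<and> \<omega> 0 = 1 \<and>
     (\<lambda>n. \<omega> n / \<omega> (n - nat \<lfloor>sqrt (real n)\<rfloor>)) \<longlonglongrightarrow> 1 \<and>
     filterlim (\<lambda>n. \<Sum>k=1..n. 1 / \<omega> k) at_top sequentially"

text \<open>
  The coefficients \<open>a\<^sub>k\<close> in \<open>g(z) = \<Sum>\<^sub>k a\<^sub>k z\<^sup>k\<close> are the Taylor coefficients of
  \<open>g\<close> at \<open>0\<close>.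
\<close>
definition taylor_coeff :: "(complex \<Rightarrow> complex) \<Rightarrow> nat \<Rightarrow> complex" where
  "taylor_coeff g k = fps_nth (fps_expansion g 0) k"

definition H2 :: "(nat \<Rightarrow> real) \<Rightarrow> (complex \<Rightarrow> complex) set" where
  "H2 \<omega> = {g. g holomorphic_on ball 0 1 \<and> summable (\<lambda>k. (cmod (taylor_coeff g k))\<^sup>2 * \<omega> k)}"

definition H2_norm :: "(nat \<Rightarrow> real) \<Rightarrow> (complex \<Rightarrow> complex) \<Rightarrow> real" where
  "H2_norm \<omega> g = sqrt (\<Sum>k. (cmod (taylor_coeff g k))\<^sup>2 * \<omega> k)"

definition is_opa ::
  "(nat \<Rightarrow> real) \<Rightarrow> (complex \<Rightarrow> complex) \<Rightarrow> nat \<Rightarrow> complex poly \<Rightarrow> bool" where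
  "is_opa \<omega> f n p \<longleftrightarrow>
     f \<in> H2 \<omega> \<and> (\<exists>z\<in>ball 0 1. f z \<noteq> 0) \<and> degree p \<le> n \<and>
     (\<forall>q. degree q \<le> n \<longrightarrow>
        H2_norm \<omega> (\<lambda>z. 1 - poly p z * f z) \<le> H2_norm \<omega> (\<lambda>z. 1 - poly q z * f z))"

definition wiener_norm :: "(complex \<Rightarrow> complex) \<Rightarrow> real" where
  "wiener_norm g = (\<Sum>k. cmod (taylor_coeff g k))"

text \<open>
  Polynomials have finitely many non-zero Taylor coefficients, so for them the series above
  are finite sums, and they lie in every \<^term>\<open>H2 \<omega>\<close>.
\<close>
lemma taylor_coeff_poly: "taylor_coeff (poly p) k = coeff p k"
proof -
  have "((deriv ^^ k) (poly p)) = poly ((pderiv ^^ k) p)"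
  proof (induction k)
    case (Suc k)
    have "deriv (poly q) = poly (pderiv q)" for q :: "complex poly"
      by (rule ext) (rule DERIV_imp_deriv, rule poly_DERIV)
    with Suc show ?case by simp
  qed simp
  moreover have "poly ((pderiv ^^ k) p) 0 = fact k * coeff p k"
    by (simp add: poly_0_coeff_0 coeff_higher_pderiv pochhammer_fact)
  ultimately show ?thesis
    by (simp add: taylor_coeff_def fps_expansion_def)
qed

lemma poly_in_H2: "poly p \<in> H2 \<omega>"
proof -
  have "summable (\<lambda>k. (cmod (coeff p k))\<^sup>2 * \<omega> k)"
    by (rule summable_finite[of "{..degree p}"]) (auto simp: coeff_eq_0)
  moreover have "poly p holomorphic_on ball 0 1"
    unfolding holomorphic_on_def field_differentiable_def
    by (blast intro: has_field_derivative_at_within poly_DERIV)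
  ultimately show ?thesis
    by (simp add: H2_def taylor_coeff_poly)
qed

lemma wiener_norm_poly: "wiener_norm (poly p) = (\<Sum>k\<le>degree p. cmod (coeff p k))"
  unfolding wiener_norm_def taylor_coeff_poly
  by (rule suminf_finite) (auto simp: coeff_eq_0)

end

(* By Cauchy-Schwarz, the Wiener norm of a polynomial g of degree at most N is at most
   H2_norm w g times the square root of S N, where S n is the sum of 1 / w k over k <= n.
   Since 1 - p_n f has minimal norm, it suffices to exhibit one competitor h = 1 - q f with
   squared norm O(1 / S n).  As f has simple zeros, any h of degree at most n + degree f that
   takes the value 1 at every zero of f is of this form, so one can take for h the sum, over
   the zeros z0 of f, of the Lagrange polynomials of f at z0 times
   u(z) = (SUM k<=n. (z / z0)^k / w k) / S n.  As |z0| >= 1, the squared norm of u is at most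
   1 / S n.  The growth condition on the weight is only used through the boundedness of the
   ratios of consecutive weights: it makes multiplication by a fixed polynomial bounded and
   S (n + degree f) comparable to S n. *)
theory Submission
  imports Defs
begin

section \<open>Weights: consecutive ratios and sums of inverses\<close>

text \<open>The quotient in the growth condition tends to 1, so it and its inverse are bounded. This
  compares \<open>\<omega> (Suc n)\<close> with an earlier \<open>\<omega> m\<close>, and
  monotonicity places \<open>\<omega> n\<close> between the two.\<close>

lemma weight_ratio_bounded:
  assumes "is_weight \<omega>"
  obtains C where "C > 0" "\<And>n. \<omega> (Suc n) \<le> C * \<omega> n" "\<And>n. \<omega> n \<le> C * \<omega> (Suc n)"
proof -
  define y where "y n = \<omega> n / \<omega> (n - nat \<lfloor>sqrt (real n)\<rfloor>)" for n
  have pos: "\<omega> k > 0" for k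
    using assms by (simp add: is_weight_def)
  have lim: "y \<longlonglongrightarrow> 1"
    using assms by (simp add: is_weight_def y_def[abs_def])
  have lim': "(\<lambda>n. inverse (y n)) \<longlonglongrightarrow> 1"
    using tendsto_inverse[OF lim] by simp
  obtain K where K: "K > 0" "\<And>n. norm (y n) \<le> K"
    using convergent_imp_Bseq[OF convergentI[OF lim]] unfolding Bseq_def by blast
  obtain L where L: "L > 0" "\<And>n. norm (inverse (y n)) \<le> L"
    using convergent_imp_Bseq[OF convergentI[OF lim']] unfolding Bseq_def by blast
  define C where "C = K + L + 1"
  have C: "C > 0" "K \<le> C" "L \<le> C" "1 \<le> C"
    using K L by (auto simp: C_def)
  have both: "\<omega> (Suc n) \<le> C * \<omega> n \<and> \<omega> n \<le> C * \<omega> (Suc n)" for n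
  proof -
    define m where "m = Suc n - nat \<lfloor>sqrt (real (Suc n))\<rfloor>"
    \<comment> \<open>The square root of a positive integer has floor at least 1, so the quotient at
      \<open>Suc n\<close> reaches back to \<open>n\<close> or further.\<close>
    have "1 \<le> nat \<lfloor>sqrt (real (Suc n))\<rfloor>"
      by (simp add: le_nat_iff le_floor_iff)
    then have m: "m \<le> n"
      by (simp add: m_def)
    have "\<omega> (Suc n) / \<omega> m \<le> K" "\<omega> m / \<omega> (Suc n) \<le> L"
      using K(2)[of "Suc n"] L(2)[of "Suc n"] pos by (auto simp: y_def m_def abs_of_pos)
    then have up: "\<omega> (Suc n) \<le> K * \<omega> m" and down: "\<omega> m \<le> L * \<omega> (Suc n)"
      using pos by (auto simp: pos_divide_le_eq)
    have one: "\<omega> k \<le> C * \<omega> k" for k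
      using mult_right_mono[OF C(4), of "\<omega> k"] pos[of k] by simp
    \<comment> \<open>In each case one inequality is monotonicity with \<open>1 \<le> C\<close>; the
      other passes through \<open>\<omega> m\<close>.\<close>
    have "mono \<omega> \<or> antimono \<omega>"
      using assms by (simp add: is_weight_def)
    then show ?thesis
    proof
      assume mono: "mono \<omega>"
      have "K * \<omega> m \<le> C * \<omega> n"
        using C K pos monoD[OF mono m] by (intro mult_mono) (auto intro: less_imp_le)
      moreover have "\<omega> n \<le> \<omega> (Suc n)"
        using mono by (simp add: monoD)
      ultimately show ?thesis
        using up one[of "Suc n"] by linarith
    next
      assume mono: "antimono \<omega>"
      have "L * \<omega> (Suc n) \<le> C * \<omega> (Suc n)"
        using C pos by (intro mult_right_mono) (auto intro: less_imp_le)
      moreover have "\<omega> n \<le> \<omega> m" "\<omega> (Suc n) \<le> \<omega> n"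
        using mono m by (simp_all add: antimonoD)
      ultimately show ?thesis
        using down one[of n] by linarith
    qed
  qed
  show ?thesis
    using that C(1) both by blast
qed

text \<open>A new last term is at most \<open>C\<close> times the preceding one, hence at most
  \<open>C\<close> times the whole preceding sum, so each further index costs a factor
  \<open>1 + C\<close>.\<close>

lemma sum_inverse_weight_le:
  fixes \<omega> :: "nat \<Rightarrow> real"
  assumes pos: "\<And>k. \<omega> k > 0" and "C > 0" and ratio: "\<And>n. \<omega> n \<le> C * \<omega> (Suc n)"
  shows "(\<Sum>k\<le>n + d. 1 / \<omega> k) \<le> (1 + C) ^ d * (\<Sum>k\<le>n. 1 / \<omega> k)"
proof (induction d)
  case (Suc d)
  let ?S = "\<lambda>n. \<Sum>k\<le>n. 1 / \<omega> k"
  have "1 / \<omega> (Suc (n + d)) \<le> C * (1 / \<omega> (n + d))"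
    using ratio[of "n + d"] pos[of "n + d"] pos[of "Suc (n + d)"] by (simp add: field_simps)
  also have "\<dots> \<le> C * ?S (n + d)"
    using pos \<open>C > 0\<close> by (intro mult_left_mono member_le_sum) (auto intro: less_imp_le)
  finally have "?S (n + Suc d) \<le> (1 + C) * ?S (n + d)"
    by (simp add: algebra_simps)
  also have "\<dots> \<le> (1 + C) * ((1 + C) ^ d * ?S n)"
    using Suc \<open>C > 0\<close> by (intro mult_left_mono) auto
  finally show ?case
    by (simp add: mult.assoc)
qed simp

section \<open>The squared weighted norm of polynomials\<close>

text \<open>The square of \<open>H2_norm\<close> on polynomials, kept as a finite sum so that
  estimates involve neither roots nor summability.\<close>

definition sq_norm :: "(nat \<Rightarrow> real) \<Rightarrow> complex poly \<Rightarrow> real" where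
  "sq_norm \<omega> p = (\<Sum>k\<le>degree p. (cmod (coeff p k))\<^sup>2 * \<omega> k)"

lemma sq_norm_eq:
  assumes "degree p \<le> m"
  shows "sq_norm \<omega> p = (\<Sum>k\<le>m. (cmod (coeff p k))\<^sup>2 * \<omega> k)"
  unfolding sq_norm_def using assms
  by (intro sum.mono_neutral_left) (auto simp: coeff_eq_0)

lemma sq_norm_nonneg:
  assumes "\<And>k. \<omega> k > 0"
  shows "0 \<le> sq_norm \<omega> p"
  unfolding sq_norm_def using assms
  by (intro sum_nonneg) (simp add: less_imp_le)

lemma H2_norm_poly: "H2_norm \<omega> (poly p) = sqrt (sq_norm \<omega> p)"
  unfolding H2_norm_def sq_norm_def taylor_coeff_poly
  by (rule arg_cong[where f = sqrt], rule suminf_finite) (auto simp: coeff_eq_0)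

lemma sq_norm_smult: "sq_norm \<omega> (smult c p) = (cmod c)\<^sup>2 * sq_norm \<omega> p"
  by (simp add: sq_norm_eq[OF degree_smult_le] sq_norm_def sum_distrib_left
      norm_mult power_mult_distrib mult.assoc)

lemma sq_norm_add_le:
  assumes "\<And>k. \<omega> k > 0"
  shows "sq_norm \<omega> (p + q) \<le> 2 * sq_norm \<omega> p + 2 * sq_norm \<omega> q"
proof -
  define m where "m = max (degree p) (degree q)"
  have norm: "(cmod (a + b))\<^sup>2 \<le> 2 * (cmod a)\<^sup>2 + 2 * (cmod b)\<^sup>2" for a b
  proof -
    have "(cmod (a + b))\<^sup>2 \<le> (cmod a + cmod b)\<^sup>2"
      by (intro power_mono norm_triangle_ineq) auto
    also have "\<dots> \<le> 2 * (cmod a)\<^sup>2 + 2 * (cmod b)\<^sup>2"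
      using sum_squares_bound[of "cmod a" "cmod b"] by (simp add: power2_sum)
    finally show ?thesis .
  qed
  have "sq_norm \<omega> (p + q) = (\<Sum>k\<le>m. (cmod (coeff p k + coeff q k))\<^sup>2 * \<omega> k)"
    using sq_norm_eq[of "p + q" m \<omega>] degree_add_le_max[of p q] by (simp add: m_def)
  also have "\<dots> \<le> (\<Sum>k\<le>m. (2 * (cmod (coeff p k))\<^sup>2 + 2 * (cmod (coeff q k))\<^sup>2) * \<omega> k)"
    using assms norm by (intro sum_mono mult_right_mono) (auto intro: less_imp_le)
  also have "\<dots> = 2 * sq_norm \<omega> p + 2 * sq_norm \<omega> q"
    using sq_norm_eq[of p m \<omega>] sq_norm_eq[of q m \<omega>]
    by (simp add: m_def sum.distrib sum_distrib_left algebra_simps)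
  finally show ?thesis .
qed

lemma sq_norm_shift_le:
  assumes "\<And>n. \<omega> (Suc n) \<le> C * \<omega> n"
  shows "sq_norm \<omega> (pCons 0 p) \<le> C * sq_norm \<omega> p"
proof -
  have "sq_norm \<omega> (pCons 0 p) = (\<Sum>k\<le>degree p. (cmod (coeff p k))\<^sup>2 * \<omega> (Suc k))"
    by (simp add: sq_norm_eq[OF degree_pCons_le] sum.atMost_Suc_shift del: sum.atMost_Suc)
  also have "\<dots> \<le> (\<Sum>k\<le>degree p. (cmod (coeff p k))\<^sup>2 * (C * \<omega> k))"
    using assms by (intro sum_mono mult_left_mono) auto
  also have "\<dots> = C * sq_norm \<omega> p"
    by (simp add: sq_norm_def sum_distrib_left mult_ac)
  finally show ?thesis .
qed

text \<open>Horner's scheme: \<open>pCons a l * u\<close> is \<open>smult a u\<close> plus the shift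
  of \<open>l * u\<close>, and the shift is bounded by the ratio condition. The constant depends on
  \<open>l\<close> but not on \<open>u\<close>.\<close>

lemma sq_norm_mult_le:
  assumes pos: "\<And>k. \<omega> k > 0" and "C > 0" and ratio: "\<And>n. \<omega> (Suc n) \<le> C * \<omega> n"
  shows "\<exists>A. \<forall>u. sq_norm \<omega> (l * u) \<le> A * sq_norm \<omega> u"
proof (induction l)
  case 0
  show ?case
    by (intro exI[of _ 0]) (simp add: sq_norm_def)
next
  case (pCons a l)
  then obtain A where A: "\<And>u. sq_norm \<omega> (l * u) \<le> A * sq_norm \<omega> u"
    by blast
  have "sq_norm \<omega> (pCons a l * u) \<le> (2 * (cmod a)\<^sup>2 + 2 * (C * A)) * sq_norm \<omega> u" for u
  proof -
    have "sq_norm \<omega> (pCons a l * u)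
        \<le> 2 * sq_norm \<omega> (smult a u) + 2 * sq_norm \<omega> (pCons 0 (l * u))"
      using sq_norm_add_le[of \<omega>, OF pos] by simp
    moreover have "sq_norm \<omega> (pCons 0 (l * u)) \<le> C * (A * sq_norm \<omega> u)"
      using sq_norm_shift_le[of \<omega> C, OF ratio, of "l * u"] mult_left_mono[OF A[of u], of C] \<open>C > 0\<close>
      by linarith
    ultimately show ?thesis
      by (simp add: sq_norm_smult algebra_simps)
  qed
  then show ?case
    by blast
qed

text \<open>Each summand may bring its own constant; since \<open>Z\<close> is finite and fixed, the
  resulting constant is still uniform in \<open>n\<close>.\<close>

lemma sq_norm_sum_le:
  fixes v :: "'a \<Rightarrow> 'b \<Rightarrow> complex poly"
  assumes pos: "\<And>k. \<omega> k > 0" and "finite Z"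
    and "\<And>z. z \<in> Z \<Longrightarrow> \<exists>A. \<forall>n. sq_norm \<omega> (v z n) \<le> A * B n"
  shows "\<exists>A. \<forall>n. sq_norm \<omega> (\<Sum>z\<in>Z. v z n) \<le> A * B n"
  using assms(2,3)
proof (induction Z rule: finite_induct)
  case empty
  show ?case
    by (intro exI[of _ 0]) (simp add: sq_norm_def)
next
  case (insert z Z)
  then obtain A A' where A: "\<And>n. sq_norm \<omega> (\<Sum>z\<in>Z. v z n) \<le> A * B n"
    and A': "\<And>n. sq_norm \<omega> (v z n) \<le> A' * B n"
    by (metis insertCI)
  have "sq_norm \<omega> (\<Sum>z\<in>insert z Z. v z n) \<le> (2 * A' + 2 * A) * B n" for n
    using sq_norm_add_le[of \<omega>, OF pos, of "v z n" "\<Sum>z\<in>Z. v z n"] A[of n] A'[of n] insert.hyps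
    by (simp add: algebra_simps)
  then show ?case
    by blast
qed

lemma wiener_norm_le:
  assumes pos: "\<And>k. \<omega> k > 0" and "degree p \<le> m"
  shows "(wiener_norm (poly p))\<^sup>2 \<le> sq_norm \<omega> p * (\<Sum>k\<le>m. 1 / \<omega> k)"
proof -
  have "wiener_norm (poly p) = (\<Sum>k\<le>m. cmod (coeff p k))"
    unfolding wiener_norm_poly using assms(2)
    by (intro sum.mono_neutral_left) (auto simp: coeff_eq_0)
  also have "\<dots> = (\<Sum>k\<le>m. (cmod (coeff p k) * sqrt (\<omega> k)) * (1 / sqrt (\<omega> k)))"
    using pos by (intro sum.cong) (auto simp: less_imp_neq[symmetric])
  also have "\<dots>\<^sup>2 \<le> (\<Sum>k\<le>m. (cmod (coeff p k) * sqrt (\<omega> k))\<^sup>2) * (\<Sum>k\<le>m. (1 / sqrt (\<omega> k))\<^sup>2)"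
    by (rule Cauchy_Schwarz_ineq_sum)
  also have "\<dots> = sq_norm \<omega> p * (\<Sum>k\<le>m. 1 / \<omega> k)"
    using pos by (simp add: sq_norm_eq[OF assms(2)] power_mult_distrib power_divide less_imp_le)
  finally show ?thesis .
qed

section \<open>Divisibility and interpolation at simple zeros\<close>

text \<open>After one linear factor is split off, the cofactor still vanishes at the other points,
  because there are no zero divisors.\<close>

lemma prod_linear_factors_dvd:
  fixes r :: "'a::idom poly"
  assumes "finite Z" "\<And>z. z \<in> Z \<Longrightarrow> poly r z = 0"
  shows "(\<Prod>z\<in>Z. [:-z, 1:]) dvd r"
  using assms
proof (induction Z arbitrary: r rule: finite_induct)
  case (insert z Z)
  then obtain s where s: "r = [:-z, 1:] * s"
    by (metis insertCI dvdE poly_eq_0_iff_dvd)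
  have "poly s x = 0" if "x \<in> Z" for x
    using insert.prems[of x] insert.hyps that by (auto simp: s)
  then have "(\<Prod>z\<in>Z. [:-z, 1:]) dvd s"
    by (rule insert.IH)
  then show ?case
    using insert.hyps by (simp add: s mult_dvd_mono del: mult_pCons_left)
qed simp

text \<open>With simple zeros, \<open>f\<close> is a constant times a product of distinct linear
  factors. This turns interpolation conditions at the zeros into divisibility by
  \<open>f\<close>.\<close>

lemma simple_zeros_dvd:
  fixes f r :: "complex poly"
  assumes "f \<noteq> 0" and simple: "\<And>z. poly f z = 0 \<Longrightarrow> order z f = 1"
    and r: "\<And>z. poly f z = 0 \<Longrightarrow> poly r z = 0"
  shows "f dvd r"
proof -
  have "f = smult (lead_coeff f) (\<Prod>z | poly f z = 0. [:-z, 1:] ^ order z f)"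
    by (rule complex_poly_decompose[symmetric])
  also have "(\<Prod>z | poly f z = 0. [:-z, 1:] ^ order z f) = (\<Prod>z | poly f z = 0. [:-z, 1:])"
    using simple by (intro prod.cong) auto
  finally have "f = smult (lead_coeff f) (\<Prod>z | poly f z = 0. [:-z, 1:])" .
  moreover have "(\<Prod>z | poly f z = 0. [:-z, 1:]) dvd r"
    using assms by (intro prod_linear_factors_dvd) (auto simp: poly_roots_finite)
  ultimately show ?thesis
    using \<open>f \<noteq> 0\<close> by (metis leading_coeff_0_iff smult_dvd_iff)
qed

text \<open>The witness is the cofactor of the linear factor at \<open>z\<close>, divided by its
  value at \<open>z\<close>, which is nonzero because the zero is simple.\<close>

lemma lagrange_poly_exists:
  fixes f :: "complex poly"
  assumes "f \<noteq> 0" "poly f z = 0" "order z f = 1"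
  shows "\<exists>l. degree l \<le> degree f \<and> poly l z = 1 \<and> (\<forall>x. poly f x = 0 \<longrightarrow> x \<noteq> z \<longrightarrow> poly l x = 0)"
proof -
  obtain g where g: "f = [:-z, 1:] * g" "\<not> [:-z, 1:] dvd g"
    using order_decomp[OF assms(1), of z] assms(3) by auto
  have "poly g z \<noteq> 0"
    using g(2) by (simp add: poly_eq_0_iff_dvd)
  moreover have "g dvd f"
    by (subst g(1)) (rule dvd_triv_right)
  then have "degree g \<le> degree f"
    using \<open>f \<noteq> 0\<close> by (rule dvd_imp_degree_le)
  ultimately show ?thesis
    using g(1) by (intro exI[of _ "smult (1 / poly g z) g"]) auto
qed

section \<open>A competitor of small norm\<close>

text \<open>For z on the unit circle, the witness is the reproducing kernel at z of the polynomials
  of degree at most n, divided by its diagonal value \<open>S\<close>. For larger |z|, dividing by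
  \<open>z ^ k\<close> keeps the value 1 and only shrinks the coefficients.\<close>

lemma kernel_poly_exists:
  fixes z :: complex
  assumes pos: "\<And>k. \<omega> k > 0" and z: "cmod z \<ge> 1"
  shows "\<exists>u. degree u \<le> n \<and> poly u z = 1 \<and> sq_norm \<omega> u \<le> 1 / (\<Sum>k\<le>n. 1 / \<omega> k)"
proof -
  define S where "S = (\<Sum>k\<le>n. 1 / \<omega> k)"
  have S: "S > 0"
    unfolding S_def using pos by (intro sum_pos) auto
  define c where "c k = of_real (1 / (\<omega> k * S)) / z ^ k" for k
  define u where "u = (\<Sum>k\<le>n. monom (c k) k)"
  have z0: "z \<noteq> 0"
    using z by auto
  have deg: "degree u \<le> n"
    unfolding u_def
    by (intro degree_sum_le) (auto intro: order.trans[OF degree_monom_le])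
  have "poly u z = of_real (\<Sum>k\<le>n. 1 / (\<omega> k * S))"
    using z0 by (simp add: u_def poly_sum poly_monom c_def)
  also have "(\<Sum>k\<le>n. 1 / (\<omega> k * S)) = S / S"
    by (subst (2) S_def) (simp add: sum_divide_distrib)
  finally have one: "poly u z = 1"
    using S by simp
  have cf: "coeff u k = c k" if "k \<le> n" for k
    using that by (simp add: u_def coeff_sum coeff_monom)
  have "sq_norm \<omega> u = (\<Sum>k\<le>n. (cmod (c k))\<^sup>2 * \<omega> k)"
    by (simp add: sq_norm_eq[OF deg] cf)
  also have "\<dots> \<le> (\<Sum>k\<le>n. (1 / (\<omega> k * S))\<^sup>2 * \<omega> k)"
  proof (intro sum_mono mult_right_mono power_mono)
    fix k
    have "1 \<le> cmod z ^ k"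
      using z by simp
    then have "1 / (\<omega> k * S) / cmod z ^ k \<le> 1 / (\<omega> k * S) / 1"
      using S pos[of k] by (intro divide_left_mono) auto
    then show "cmod (c k) \<le> 1 / (\<omega> k * S)"
      using S pos[of k] by (simp add: c_def norm_divide norm_mult norm_power abs_of_pos)
  qed (use pos in \<open>auto intro: less_imp_le\<close>)
  also have "\<dots> = (\<Sum>k\<le>n. 1 / \<omega> k / S\<^sup>2)"
    using pos by (intro sum.cong) (auto simp: power2_eq_square less_imp_neq[symmetric])
  also have "\<dots> = S / S\<^sup>2"
    by (simp only: S_def sum_divide_distrib)
  also have "\<dots> = 1 / S"
    using S by (simp add: power2_eq_square)
  finally show ?thesis
    using deg one unfolding S_def by blast
qed

lemma competitor_exists:
  fixes f :: "complex poly"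
  assumes pos: "\<And>k. \<omega> k > 0" and "C > 0" and ratio: "\<And>n. \<omega> (Suc n) \<le> C * \<omega> n"
    and "f \<noteq> 0" and simple: "\<And>z. poly f z = 0 \<Longrightarrow> order z f = 1"
    and outside: "\<And>z. poly f z = 0 \<Longrightarrow> cmod z \<ge> 1"
  shows "\<exists>A. \<forall>n. \<exists>q. degree q \<le> n \<and> sq_norm \<omega> (1 - q * f) \<le> A / (\<Sum>k\<le>n. 1 / \<omega> k)"
proof -
  define Z where "Z = {z. poly f z = 0}"
  have fin: "finite Z"
    using \<open>f \<noteq> 0\<close> by (simp add: Z_def poly_roots_finite)
  have "\<exists>l. \<forall>z\<in>Z. degree (l z) \<le> degree f \<and> poly (l z) z = 1 \<and>
      (\<forall>x. poly f x = 0 \<longrightarrow> x \<noteq> z \<longrightarrow> poly (l z) x = 0)"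
    using lagrange_poly_exists[OF \<open>f \<noteq> 0\<close>] simple unfolding Z_def by (intro bchoice) blast
  then obtain l where l: "\<And>z. z \<in> Z \<Longrightarrow> degree (l z) \<le> degree f"
      "\<And>z. z \<in> Z \<Longrightarrow> poly (l z) z = 1"
      "\<And>z x. z \<in> Z \<Longrightarrow> x \<in> Z \<Longrightarrow> x \<noteq> z \<Longrightarrow> poly (l z) x = 0"
    unfolding Z_def by blast
  have "\<exists>u. \<forall>z\<in>Z. \<forall>n. degree (u z n) \<le> n \<and> poly (u z n) z = 1 \<and>
      sq_norm \<omega> (u z n) \<le> 1 / (\<Sum>k\<le>n. 1 / \<omega> k)"
    using kernel_poly_exists[of \<omega>, OF pos outside] unfolding Z_def by (intro bchoice ballI choice) blast
  then obtain u where u: "\<And>z n. z \<in> Z \<Longrightarrow> degree (u z n) \<le> n"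
      "\<And>z n. z \<in> Z \<Longrightarrow> poly (u z n) z = 1"
      "\<And>z n. z \<in> Z \<Longrightarrow> sq_norm \<omega> (u z n) \<le> 1 / (\<Sum>k\<le>n. 1 / \<omega> k)"
    by blast
  \<comment> \<open>If \<open>f\<close> is a nonzero constant, then \<open>Z\<close> is empty and
    \<open>h n\<close> is 0.\<close>
  define h where "h n = (\<Sum>z\<in>Z. l z * u z n)" for n
  have "\<exists>A. \<forall>n. sq_norm \<omega> (l z * u z n) \<le> A * (1 / (\<Sum>k\<le>n. 1 / \<omega> k))" if z: "z \<in> Z" for z
  proof -
    obtain A where A: "\<And>v. sq_norm \<omega> (l z * v) \<le> A * sq_norm \<omega> v"
      using sq_norm_mult_le[of \<omega> C, OF pos \<open>C > 0\<close> ratio] by blast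
    \<comment> \<open>The sign of \<open>A\<close> is unknown; the absolute value allows the bound
      on \<open>u z n\<close> to be multiplied by it.\<close>
    have "sq_norm \<omega> (l z * u z n) \<le> \<bar>A\<bar> * (1 / (\<Sum>k\<le>n. 1 / \<omega> k))" for n
    proof -
      have "0 \<le> sq_norm \<omega> (u z n)"
        by (rule sq_norm_nonneg[of \<omega>, OF pos])
      then have "A * sq_norm \<omega> (u z n) \<le> \<bar>A\<bar> * sq_norm \<omega> (u z n)"
        by (intro mult_right_mono) auto
      also have "\<dots> \<le> \<bar>A\<bar> * (1 / (\<Sum>k\<le>n. 1 / \<omega> k))"
        using u(3)[OF z] by (intro mult_left_mono) auto
      finally show ?thesis
        using A[of "u z n"] by linarith
    qed
    then show ?thesis
      by blast
  qed
  then have "\<exists>A. \<forall>n. sq_norm \<omega> (\<Sum>z\<in>Z. l z * u z n) \<le> A * (1 / (\<Sum>k\<le>n. 1 / \<omega> k))"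
    by (rule sq_norm_sum_le[of \<omega>, OF pos fin])
  then obtain A where A: "\<And>n. sq_norm \<omega> (h n) \<le> A * (1 / (\<Sum>k\<le>n. 1 / \<omega> k))"
    unfolding h_def by blast
  have "\<exists>q. degree q \<le> n \<and> sq_norm \<omega> (1 - q * f) \<le> A / (\<Sum>k\<le>n. 1 / \<omega> k)" for n
  proof -
    have "poly (h n) z = 1" if z: "z \<in> Z" for z
    proof -
      \<comment> \<open>The Lagrange factors kill every summand except the one belonging to
        \<open>z\<close>.\<close>
      have "poly (h n) z = (\<Sum>x\<in>Z. if x = z then 1 else 0)"
        unfolding h_def poly_sum using l u z by (intro sum.cong) auto
      then show ?thesis
        using z fin by simp
    qed
    then have "f dvd 1 - h n"
      using simple_zeros_dvd[OF \<open>f \<noteq> 0\<close> simple, of "1 - h n"] by (simp add: Z_def)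
    then obtain q where q: "1 - h n = q * f"
      by (metis dvdE mult.commute)
    \<comment> \<open>The Lagrange factor costs at most \<open>degree f\<close>, exactly what is
      regained when \<open>f\<close> is cancelled from \<open>q * f\<close>.\<close>
    have "degree (l z * u z n) \<le> degree f + n" if "z \<in> Z" for z
      using degree_mult_le[of "l z" "u z n"] l(1)[OF that] u(1)[OF that, of n] by linarith
    then have "degree (h n) \<le> degree f + n"
      unfolding h_def using fin by (intro degree_sum_le) auto
    then have "degree (q * f) \<le> degree f + n"
      unfolding q[symmetric] by (intro degree_diff_le) auto
    then have "degree q \<le> n"
      using \<open>f \<noteq> 0\<close> by (cases "q = 0") (auto simp: degree_mult_eq)
    moreover have "1 - q * f = h n"
      by (simp flip: q)
    ultimately show ?thesis
      using A[of n] by auto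
  qed
  then show ?thesis
    by blast
qed

section \<open>Minimality and the Wiener norm bound\<close>

theorem theorem1p4:
  fixes \<omega> :: "nat \<Rightarrow> real" and f :: "complex poly" and p :: "nat \<Rightarrow> complex poly"
  assumes "is_weight \<omega>"
    and "\<forall>z. poly f z = 0 \<longrightarrow> order z f = 1"
    and "{z. poly f z = 0} \<inter> ball 0 1 = {}"
    and "\<forall>n. is_opa \<omega> (poly f) n (p n)"
  shows "\<exists>C>0. \<forall>n. wiener_norm (\<lambda>z. 1 - poly (p n) z * poly f z) \<le> C"
proof -
  have pos: "\<omega> k > 0" for k
    using assms(1) by (simp add: is_weight_def)
  obtain C where C: "C > 0" "\<And>n. \<omega> (Suc n) \<le> C * \<omega> n" "\<And>n. \<omega> n \<le> C * \<omega> (Suc n)"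
    using weight_ratio_bounded[OF assms(1)] by metis
  have f0: "f \<noteq> 0"
    using assms(4) by (auto simp: is_opa_def)
  have outside: "cmod z \<ge> 1" if "poly f z = 0" for z
    using assms(3) that by (auto simp: disjoint_iff not_less)
  have eq: "(\<lambda>z. 1 - poly q z * poly f z) = poly (1 - q * f)" for q
    by auto
  obtain A where A: "\<And>n. \<exists>q. degree q \<le> n \<and> sq_norm \<omega> (1 - q * f) \<le> A / (\<Sum>k\<le>n. 1 / \<omega> k)"
    using competitor_exists[of \<omega> C f, OF pos C(1,2) f0 _ outside] assms(2) by metis
  \<comment> \<open>\<open>A\<close> comes from the competitor, the power from lengthening the sum
    of inverses from \<open>n\<close> to \<open>n + degree f\<close>.\<close>
  define B where "B = A * (1 + C) ^ degree f"
  \<comment> \<open>The absolute value and the added 1 make the constant positive whatever the sign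
    of \<open>B\<close>.\<close>
  have "wiener_norm (\<lambda>z. 1 - poly (p n) z * poly f z) \<le> \<bar>sqrt B\<bar> + 1" for n
  proof -
    let ?S = "\<lambda>n. \<Sum>k\<le>n. 1 / \<omega> k" and ?g = "1 - p n * f"
    have S: "?S n > 0" for n
      using pos by (intro sum_pos) auto
    obtain q where q: "degree q \<le> n" "sq_norm \<omega> (1 - q * f) \<le> A / ?S n"
      using A by blast
    have opa: "degree (p n) \<le> n" "H2_norm \<omega> (poly ?g) \<le> H2_norm \<omega> (poly (1 - q * f))"
      using assms(4) q(1) by (auto simp: is_opa_def eq)
    have g: "sq_norm \<omega> ?g \<le> A / ?S n"
      using opa(2) q(2) by (simp add: H2_norm_poly)
    have g0: "0 \<le> sq_norm \<omega> ?g"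
      by (rule sq_norm_nonneg[of \<omega>, OF pos])
    have "degree ?g \<le> n + degree f"
      using degree_mult_le[of "p n" f] opa(1) by (intro degree_diff_le) auto
    then have "(wiener_norm (poly ?g))\<^sup>2 \<le> sq_norm \<omega> ?g * ?S (n + degree f)"
      by (intro wiener_norm_le pos)
    also have "\<dots> \<le> sq_norm \<omega> ?g * ((1 + C) ^ degree f * ?S n)"
      by (intro mult_left_mono sum_inverse_weight_le pos C g0)
    \<comment> \<open>Minimality of the approximant enters through \<open>g\<close>; the sums then
      cancel, leaving a bound free of \<open>n\<close>.\<close>
    also have "\<dots> \<le> A / ?S n * ((1 + C) ^ degree f * ?S n)"
      using g S[of n] C(1) by (intro mult_right_mono) auto
    also have "\<dots> = B"
      using S[of n] by (simp add: B_def)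
    finally have "wiener_norm (poly ?g) \<le> sqrt B"
      by (rule real_le_rsqrt)
    then show ?thesis
      unfolding eq by linarith
  qed
  then show ?thesis
    by (intro exI[of _ "\<bar>sqrt B\<bar> + 1"] conjI allI) auto
qed

end
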